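(* Let $n\ge 2$. (a) The assignments $s_i\mapsto -s_i$, $D_i\mapsto 1-D_i$ ($i=1,\ldots,n-1$) define an automorphism of the algebra $\mathbf{H}(S_n)$. (b) The assignments $s_i\mapsto -s_i$, $D_i\mapsto s_i+D_i$ ($i=1,\ldots,n-1$) define an automorphism of the algebra $\mathbf{H}(S_n)$. (c) The assignments $s_i\mapsto s_i$, $D_i\mapsto D_i$ ($i=1,\ldots,n-1$) define an anti-automorphism of the algebra $\mathbf{H}(S_n)$.
   Context: For $n\ge 2$, $\mathbf{H}(S_n)$ denotes the (unital associative) $\mathbb{Z}$-algebra generated by $s_i$ and $D_i$, $i=1,\ldots,n-1$, subject to the relations: (1) $s_i^2=1$, $s_iD_i+D_is_i=s_i-1$, $D_i^2=D_i$ for $i=1,\ldots,n-1$; (2) $s_js_i=s_is_j$, $D_js_i=s_iD_j$, $D_jD_i=D_iD_j$ if $|i-j|>1$; (3) $s_js_is_j=s_is_js_i$, $D_is_js_i=s_js_iD_j$, $D_js_iD_j=s_iD_jD_i+D_iD_js_i+s_iD_js_i$ if $|i-j|=1$. (Anti-)automorphisms are those of $\mathbb{Z}$-algebras. *)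

theory Defs
  imports "HOL-Library.Poly_Mapping" "HOL-Algebra.QuotRing"
begin

section \<open>Free associative algebras over the integers\<close>

text \<open>
  The free monoid is written additively, because the convolution product on \<^typ>\<open>'a \<Rightarrow>\<^sub>0 int\<close>
  expects a (not necessarily commutative) \<^class>\<open>monoid_add\<close> of exponents. The type
  \<open>'g word \<Rightarrow>\<^sub>0 int\<close> is then the free unital associative ring on all of \<open>'g\<close>.
\<close>

datatype 'g word = Word (letters: "'g list")

instantiation word :: (type) monoid_add
begin

definition zero_word :: "'a word" where "0 = Word []"

definition plus_word :: "'a word \<Rightarrow> 'a word \<Rightarrow> 'a word"
  where "u + v = Word (letters u @ letters v)"

instance by standard (simp_all add: zero_word_def plus_word_def)

end

definition var :: "'g \<Rightarrow> 'g word \<Rightarrow>\<^sub>0 int"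
  where "var x = Poly_Mapping.single (Word [x]) 1"

definition free_algebra :: "'g set \<Rightarrow> ('g word \<Rightarrow>\<^sub>0 int) ring"
  where "free_algebra X =
    \<lparr>carrier = {p. \<forall>w\<in>Poly_Mapping.keys p. set (letters w) \<subseteq> X},
     mult = (*), one = 1, zero = 0, add = (+)\<rparr>"

lemma var_in_free_algebra: "x \<in> X \<Longrightarrow> var x \<in> carrier (free_algebra X)"
  by (simp add: var_def free_algebra_def)

lemma one_in_free_algebra: "1 \<in> carrier (free_algebra X)"
  by (simp add: free_algebra_def zero_word_def)

lemma add_in_free_algebra:
  assumes "p \<in> carrier (free_algebra X)" "q \<in> carrier (free_algebra X)"
  shows "p + q \<in> carrier (free_algebra X)"
  using assms Poly_Mapping.keys_add[of p q] by (auto simp: free_algebra_def)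

lemma uminus_in_free_algebra: "p \<in> carrier (free_algebra X) \<Longrightarrow> - p \<in> carrier (free_algebra X)"
  by (simp add: free_algebra_def)

lemma diff_in_free_algebra:
  assumes "p \<in> carrier (free_algebra X)" "q \<in> carrier (free_algebra X)"
  shows "p - q \<in> carrier (free_algebra X)"
  using add_in_free_algebra[OF assms(1) uminus_in_free_algebra[OF assms(2)]] by simp

lemma mult_in_free_algebra:
  assumes "p \<in> carrier (free_algebra X)" "q \<in> carrier (free_algebra X)"
  shows "p * q \<in> carrier (free_algebra X)"
proof -
  have "set (letters w) \<subseteq> X" if w: "w \<in> Poly_Mapping.keys (p * q)" for w
  proof -
    obtain u v where "w = u + v" "u \<in> Poly_Mapping.keys p" "v \<in> Poly_Mapping.keys q"
      using w Poly_Mapping.keys_mult[of p q] by blast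
    then show ?thesis
      using assms by (simp add: free_algebra_def plus_word_def)
  qed
  then show ?thesis by (simp add: free_algebra_def)
qed

lemmas free_algebra_closed =
  var_in_free_algebra one_in_free_algebra add_in_free_algebra uminus_in_free_algebra
  diff_in_free_algebra mult_in_free_algebra

lemma free_algebra_ops:
  "mult (free_algebra X) = (*)" "one (free_algebra X) = 1"
  "zero (free_algebra X) = 0" "add (free_algebra X) = (+)"
  by (simp_all add: free_algebra_def)

lemma ring_free_algebra: "ring (free_algebra X)"
proof (intro ringI abelian_groupI monoidI, unfold free_algebra_ops)
  show "0 \<in> carrier (free_algebra X)"
    by (simp add: free_algebra_def)
  fix p assume "p \<in> carrier (free_algebra X)"
  then show "\<exists>q\<in>carrier (free_algebra X). q + p = 0"
    using uminus_in_free_algebra by (intro bexI[of _ "- p"]) simp_all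
qed (simp_all add: free_algebra_closed algebra_simps)

section \<open>The algebra \<open>H(S_n)\<close>\<close>

datatype gen = S nat | D nat

definition gens :: "nat \<Rightarrow> gen set"
  where "gens n = S ` {1..<n} \<union> D ` {1..<n}"

abbreviation (input) far :: "nat \<Rightarrow> nat \<Rightarrow> bool"
  where "far i j \<equiv> \<bar>int i - int j\<bar> > 1"

abbreviation (input) adjacent :: "nat \<Rightarrow> nat \<Rightarrow> bool"
  where "adjacent i j \<equiv> \<bar>int i - int j\<bar> = 1"

text \<open>A pair \<open>(p, q)\<close> stands for the defining relation \<open>p = q\<close>.\<close>

definition relations :: "nat \<Rightarrow> ((gen word \<Rightarrow>\<^sub>0 int) \<times> (gen word \<Rightarrow>\<^sub>0 int)) set"
  where "relations n =
    (let s = (\<lambda>i. var (S i)); d = (\<lambda>i. var (D i)) in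
      (\<Union>i\<in>{1..<n}.
        {(s i * s i, 1),
         (s i * d i + d i * s i, s i - 1),
         (d i * d i, d i)}) \<union>
      (\<Union>i\<in>{1..<n}. \<Union>j\<in>{j\<in>{1..<n}. far i j}.
        {(s j * s i, s i * s j),
         (d j * s i, s i * d j),
         (d j * d i, d i * d j)}) \<union>
      (\<Union>i\<in>{1..<n}. \<Union>j\<in>{j\<in>{1..<n}. adjacent i j}.
        {(s j * s i * s j, s i * s j * s i),
         (d i * s j * s i, s j * s i * d j),
         (d j * s i * d j, s i * d j * d i + d i * d j * s i + s i * d j * s i)}))"

text \<open>\<^const>\<open>genideal\<close> produces the two-sided ideal.\<close>

definition rel_ideal :: "nat \<Rightarrow> (gen word \<Rightarrow>\<^sub>0 int) set"
  where "rel_ideal n = Idl\<^bsub>free_algebra (gens n)\<^esub> {p - q |p q. (p, q) \<in> relations n}"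

definition HS :: "nat \<Rightarrow> (gen word \<Rightarrow>\<^sub>0 int) set ring"
  where "HS n = free_algebra (gens n) Quot rel_ideal n"

definition s_gen :: "nat \<Rightarrow> nat \<Rightarrow> (gen word \<Rightarrow>\<^sub>0 int) set"
  where "s_gen n i = rel_ideal n +>\<^bsub>free_algebra (gens n)\<^esub> var (S i)"

definition D_gen :: "nat \<Rightarrow> nat \<Rightarrow> (gen word \<Rightarrow>\<^sub>0 int) set"
  where "D_gen n i = rel_ideal n +>\<^bsub>free_algebra (gens n)\<^esub> var (D i)"

lemma relations_in_free_algebra:
  assumes "(p, q) \<in> relations n"
  shows "p - q \<in> carrier (free_algebra (gens n))"
proof -
  have [simp]: "var (S i) \<in> carrier (free_algebra (gens n))"
    "var (D i) \<in> carrier (free_algebra (gens n))" if "i \<in> {1..<n}" for i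
    using that by (auto intro!: var_in_free_algebra simp: gens_def)
  have "\<forall>(p, q)\<in>relations n. p - q \<in> carrier (free_algebra (gens n))"
    unfolding relations_def Let_def ball_Un ball_UN
    by (intro conjI ballI; elim CollectE conjE insertE emptyE;
        simp add: free_algebra_closed del: atLeastLessThan_iff)
  then show ?thesis using assms by blast
qed

lemma ideal_rel_ideal: "ideal (rel_ideal n) (free_algebra (gens n))"
  unfolding rel_ideal_def
  by (rule ring.genideal_ideal[OF ring_free_algebra]) (use relations_in_free_algebra in blast)

lemma ring_HS: "ring (HS n)"
  unfolding HS_def by (rule ideal.quotient_is_ring[OF ideal_rel_ideal])

section \<open>Automorphisms and anti-automorphisms\<close>

text \<open>
  A unital ring homomorphism is automatically linear over the integers, so algebra automorphisms
  of \<open>R\<close> are the elements of \<^term>\<open>ring_iso R R\<close>. Since a map is only relevant on the carrier,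
  it is normalised to be \<^const>\<open>undefined\<close> elsewhere; this makes uniqueness meaningful.
\<close>

definition automorphisms :: "('a, 'm) ring_scheme \<Rightarrow> ('a \<Rightarrow> 'a) set"
  where "automorphisms R = ring_iso R R \<inter> extensional (carrier R)"

definition antiautomorphisms :: "('a, 'm) ring_scheme \<Rightarrow> ('a \<Rightarrow> 'a) set"
  where "antiautomorphisms R =
    {h \<in> extensional (carrier R). bij_betw h (carrier R) (carrier R) \<and>
      (\<forall>x\<in>carrier R. \<forall>y\<in>carrier R. h (x \<oplus>\<^bsub>R\<^esub> y) = h x \<oplus>\<^bsub>R\<^esub> h y) \<and>
      (\<forall>x\<in>carrier R. \<forall>y\<in>carrier R. h (x \<otimes>\<^bsub>R\<^esub> y) = h y \<otimes>\<^bsub>R\<^esub> h x) \<and>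
      h \<one>\<^bsub>R\<^esub> = \<one>\<^bsub>R\<^esub>}"

end

theory Submission
  imports Defs
begin

text \<open>
  Each assignment extends to an endomorphism or antiendomorphism \<open>h\<close> of the free algebra. It maps
  every defining relation to an integral linear combination of defining relations (no further
  multiplication is needed), so \<open>h\<close> preserves the ideal of relations. Moreover \<open>h\<close> is already an
  involution on the free algebra, since it is one on the generators. Hence the map induced on
  cosets is simply the direct image under \<open>h\<close>, and it is its own inverse. Uniqueness holds because
  the classes of the generators generate the quotient.
\<close>

section \<open>Free algebras\<close>

lemma a_inv_free_algebra:
  assumes "p \<in> carrier (free_algebra X)"
  shows "\<ominus>\<^bsub>free_algebra X\<^esub> p = - p"
proof -
  interpret ring "free_algebra X" by (rule ring_free_algebra)
  show ?thesis
    using assms uminus_in_free_algebra[OF assms]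
    by (intro minus_equality) (simp_all add: free_algebra_ops)
qed

text \<open>Links the additive basis of words with the ring structure: an induction over integer
  combinations of words becomes one over products of generators.\<close>

lemma frag_of_Word: "frag_of (Word xs) = prod_list (map var xs)"
proof (induction xs)
  case Nil
  then show ?case by (simp flip: zero_word_def)
next
  case (Cons x xs)
  have "frag_of (Word (x # xs)) = var x * frag_of (Word xs)"
    by (simp add: var_def mult_single plus_word_def)
  with Cons show ?case by simp
qed

text \<open>Elements are integer combinations of words and words are products of variables. Closure
  under differences covers sums, negatives and zero, so these need no cases of their own.\<close>

lemma free_algebra_induct [consumes 1, case_names one var mult diff]:
  assumes p: "p \<in> carrier (free_algebra X)"
    and one: "P 1"
    and var: "\<And>x. x \<in> X \<Longrightarrow> P (var x)"
    and mult: "\<And>p q. \<lbrakk>p \<in> carrier (free_algebra X); q \<in> carrier (free_algebra X); P p; P q\<rbrakk>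
      \<Longrightarrow> P (p * q)"
    and diff: "\<And>p q. \<lbrakk>p \<in> carrier (free_algebra X); q \<in> carrier (free_algebra X); P p; P q\<rbrakk>
      \<Longrightarrow> P (p - q)"
  shows "P p"
proof -
  \<comment> \<open>Membership is carried along because the hypotheses \<open>mult\<close> and
    \<open>diff\<close> demand it of both arguments.\<close>
  let ?Q = "\<lambda>p. p \<in> carrier (free_algebra X) \<and> P p"
  have word: "?Q (prod_list (map var xs))" if "set xs \<subseteq> X" for xs
    using that by (induction xs) (auto intro: one var mult free_algebra_closed)
  have "Poly_Mapping.keys p \<subseteq> {w. set (letters w) \<subseteq> X}"
    using p by (auto simp: free_algebra_def)
  then have "?Q p"
  proof (induction p rule: frag_induction)
    case zero
    \<comment> \<open>There is no zero case among the hypotheses, so zero is obtained as a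
      difference of units.\<close>
    have "?Q (1 - 1)"
      by (intro conjI diff_in_free_algebra one_in_free_algebra diff one)
    then show ?case by simp
  next
    case (one w)
    then show ?case using word[of "letters w"] by (simp flip: frag_of_Word)
  next
    case (diff a b)
    \<comment> \<open>Inside this case \<open>diff\<close> names the induction facts;
      \<open>assms(5)\<close> is the closure hypothesis of the lemma.\<close>
    then show ?case by (auto intro: diff_in_free_algebra assms(5))
  qed
  then show ?thesis by blast
qed

section \<open>Substitution homomorphisms and antihomomorphisms\<close>

text \<open>The flag selects between homomorphisms (\<^const>\<open>False\<close>) and antihomomorphisms (\<^const>\<open>True\<close>).\<close>

definition twist :: "bool \<Rightarrow> ('a \<Rightarrow> 'a \<Rightarrow> 'b) \<Rightarrow> 'a \<Rightarrow> 'a \<Rightarrow> 'b"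
  where "twist b m x y = (if b then m y x else m x y)"

text \<open>The universal property of the free algebra. Linear extension from the basis of words
  makes additivity automatic, and reversing the letters is what reverses products.\<close>

definition subst :: "bool \<Rightarrow> ('g \<Rightarrow> 'h word \<Rightarrow>\<^sub>0 int) \<Rightarrow> ('g word \<Rightarrow>\<^sub>0 int) \<Rightarrow> 'h word \<Rightarrow>\<^sub>0 int"
  where "subst b f =
    frag_extend (\<lambda>w. prod_list (map f (if b then rev (letters w) else letters w)))"

lemma subst_add: "subst b f (p + q) = subst b f p + subst b f q"
  and subst_diff: "subst b f (p - q) = subst b f p - subst b f q"
  and subst_minus: "subst b f (- p) = - subst b f p"
  and subst_zero: "subst b f 0 = 0"
  by (simp_all add: subst_def frag_extend_add frag_extend_diff frag_extend_minus)

lemma subst_var: "subst b f (var x) = f x"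
  by (simp add: subst_def var_def)

lemma subst_one: "subst b f 1 = 1"
  by (simp add: subst_def zero_word_def flip: single_one)

text \<open>Both sides are additive in each argument, so single words suffice. There the claim is
  that \<open>map\<close> and \<open>rev\<close> respect concatenation, with \<open>rev\<close>
  swapping the factors.\<close>

lemma subst_mult: "subst b f (p * q) = twist b (*) (subst b f p) (subst b f q)"
proof (induction p rule: frag_induction[OF subset_UNIV, case_names zero one diff])
  case (one u)
  show ?case
  proof (induction q rule: frag_induction[OF subset_UNIV, case_names zero one diff])
    case (one v)
    show ?case
      by (simp add: mult_single subst_def twist_def plus_word_def)
  qed (simp_all add: subst_zero subst_diff twist_def algebra_simps)
qed (simp_all add: subst_zero subst_diff twist_def algebra_simps)

lemmas subst_simps =
  subst_add subst_diff subst_minus subst_zero subst_one subst_var subst_mult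

lemma subst_closed:
  assumes "p \<in> carrier (free_algebra X)"
    and "\<And>x. x \<in> X \<Longrightarrow> f x \<in> carrier (free_algebra Y)"
  shows "subst b f p \<in> carrier (free_algebra Y)"
  using assms(1)
  by (induction p rule: free_algebra_induct)
    (auto simp: assms(2) subst_simps twist_def free_algebra_closed)

text \<open>For either flag the square of \<open>subst b f\<close> preserves products in their
  order, since two reversals cancel. Hence checking generators is enough.\<close>

lemma subst_involutive:
  assumes "p \<in> carrier (free_algebra X)"
    and "\<And>x. x \<in> X \<Longrightarrow> subst b f (f x) = var x"
  shows "subst b f (subst b f p) = p"
  using assms(1)
  by (induction p rule: free_algebra_induct)
    (auto simp: assms(2) subst_simps twist_def)

text \<open>The preimage of the ideal is itself an ideal containing \<open>G\<close>, so minimality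
  of the generated ideal applies.\<close>

lemma subst_genideal:
  assumes G: "G \<subseteq> carrier (free_algebra X)"
    and f: "\<And>x. x \<in> X \<Longrightarrow> f x \<in> carrier (free_algebra X)"
    and sG: "\<And>p. p \<in> G \<Longrightarrow> subst b f p \<in> Idl\<^bsub>free_algebra X\<^esub> G"
    and p: "p \<in> Idl\<^bsub>free_algebra X\<^esub> G"
  shows "subst b f p \<in> Idl\<^bsub>free_algebra X\<^esub> G"
proof -
  let ?F = "free_algebra X"
  interpret F: ring ?F by (rule ring_free_algebra)
  interpret I: ideal "Idl\<^bsub>?F\<^esub> G" ?F by (rule F.genideal_ideal[OF G])
  let ?J = "{p \<in> carrier ?F. subst b f p \<in> Idl\<^bsub>?F\<^esub> G}"
  have "ideal ?J ?F"
  proof (intro idealI ring_free_algebra F.add.subgroupI)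
    show "?J \<subseteq> carrier ?F" by blast
    show "?J \<noteq> {}"
      using I.zero_closed F.zero_closed by (auto simp: free_algebra_ops subst_zero)
  next
    fix p assume p: "p \<in> ?J"
    with I.a_inv_closed[of "subst b f p"] show "\<ominus>\<^bsub>?F\<^esub> p \<in> ?J"
      by (simp add: a_inv_free_algebra subst_minus uminus_in_free_algebra subst_closed f)
  next
    fix p q assume "p \<in> ?J" "q \<in> ?J"
    then show "p \<oplus>\<^bsub>?F\<^esub> q \<in> ?J"
      using I.a_closed[of "subst b f p" "subst b f q"]
      by (simp add: free_algebra_ops subst_add add_in_free_algebra)
  next
    fix p q assume pq: "p \<in> ?J" "q \<in> carrier ?F"
    then have "subst b f q \<in> carrier ?F" by (simp add: subst_closed f)
    then show "q \<otimes>\<^bsub>?F\<^esub> p \<in> ?J" "p \<otimes>\<^bsub>?F\<^esub> q \<in> ?J"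
      using pq I.I_l_closed[of "subst b f p" "subst b f q"]
        I.I_r_closed[of "subst b f p" "subst b f q"]
      \<comment> \<open>An antihomomorphism exchanges left and right multiplication; the ideal is
        two-sided and absorbs both.\<close>
      by (cases b; simp add: free_algebra_ops subst_mult twist_def mult_in_free_algebra)+
  qed
  then have "Idl\<^bsub>?F\<^esub> G \<subseteq> ?J"
    using G sG by (intro F.genideal_minimal) auto
  with p show ?thesis by blast
qed

section \<open>Involutions of finitely presented algebras\<close>

text \<open>A common form of automorphisms and antiautomorphisms, so that existence and uniqueness
  are proved once for both.\<close>

definition twisted_automorphisms :: "bool \<Rightarrow> ('a, 'm) ring_scheme \<Rightarrow> ('a \<Rightarrow> 'a) set"
  where "twisted_automorphisms b R =
    {h \<in> extensional (carrier R). bij_betw h (carrier R) (carrier R) \<and>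
      (\<forall>x\<in>carrier R. \<forall>y\<in>carrier R. h (x \<oplus>\<^bsub>R\<^esub> y) = h x \<oplus>\<^bsub>R\<^esub> h y) \<and>
      (\<forall>x\<in>carrier R. \<forall>y\<in>carrier R. h (x \<otimes>\<^bsub>R\<^esub> y) = twist b (mult R) (h x) (h y)) \<and>
      h \<one>\<^bsub>R\<^esub> = \<one>\<^bsub>R\<^esub>}"

lemma twisted_automorphisms_False: "twisted_automorphisms False R = automorphisms R"
  by (auto simp: twisted_automorphisms_def automorphisms_def ring_iso_def ring_hom_def
      twist_def bij_betw_def)

lemma twisted_automorphisms_True: "twisted_automorphisms True R = antiautomorphisms R"
  by (simp add: twisted_automorphisms_def antiautomorphisms_def twist_def)

text \<open>Additivity applied to \<open>x = (x - y) + y\<close>. It serves the difference case of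
  \<open>free_algebra_induct\<close>.\<close>

lemma twisted_automorphism_minus:
  assumes R: "ring R" and h: "h \<in> twisted_automorphisms b R"
    and x: "x \<in> carrier R" and y: "y \<in> carrier R"
  shows "h (x \<ominus>\<^bsub>R\<^esub> y) = h x \<ominus>\<^bsub>R\<^esub> h y"
proof -
  interpret ring R by (rule R)
  have closed: "\<And>z. z \<in> carrier R \<Longrightarrow> h z \<in> carrier R"
    using h by (auto simp: twisted_automorphisms_def bij_betw_def)
  have "h x = h ((x \<ominus>\<^bsub>R\<^esub> y) \<oplus>\<^bsub>R\<^esub> y)"
    using x y by (simp add: a_minus_def a_assoc l_neg)
  also have "\<dots> = h (x \<ominus>\<^bsub>R\<^esub> y) \<oplus>\<^bsub>R\<^esub> h y"
    using h x y by (simp add: twisted_automorphisms_def)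
  finally show ?thesis
    using x y closed by (simp add: a_minus_def a_assoc r_neg)
qed

section \<open>Induced maps on quotients of free algebras\<close>

lemma carrier_FactRing: "carrier (R Quot I) = (\<lambda>x. I +>\<^bsub>R\<^esub> x) ` carrier R"
  unfolding FactRing_def A_RCOSETS_def' by auto

text \<open>Agreement on cosets of generators spreads to all cosets by induction on representatives;
  extensionality settles arguments outside the carrier.\<close>

lemma twisted_automorphism_eqI:
  fixes X :: "'g set" and I
  defines "F \<equiv> free_algebra X"
  assumes I: "ideal I F"
    and \<phi>: "\<phi> \<in> twisted_automorphisms b (F Quot I)"
    and \<psi>: "\<psi> \<in> twisted_automorphisms b (F Quot I)"
    and eq: "\<And>x. x \<in> X \<Longrightarrow> \<phi> (I +>\<^bsub>F\<^esub> var x) = \<psi> (I +>\<^bsub>F\<^esub> var x)"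
  shows "\<phi> = \<psi>"
proof -
  interpret I: ideal I F by (rule I)
  interpret \<pi>: ring_hom_ring F "F Quot I" "(+>\<^bsub>F\<^esub>) I" by (rule I.rcos_ring_hom_ring)
  have Q: "ring (F Quot I)" by (rule I.quotient_is_ring)
  have agree: "\<phi> (I +>\<^bsub>F\<^esub> p) = \<psi> (I +>\<^bsub>F\<^esub> p)" if "p \<in> carrier F" for p
    using that unfolding F_def
  proof (induction p rule: free_algebra_induct)
    case one
    show ?case
      using \<pi>.hom_one \<phi> \<psi> by (simp add: twisted_automorphisms_def F_def free_algebra_ops)
  next
    case (var x)
    then show ?case using eq by (simp add: F_def)
  next
    case (mult p q)
    then show ?case
      using \<pi>.hom_mult[of p q] \<pi>.hom_closed[of p] \<pi>.hom_closed[of q] \<phi> \<psi>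
      by (simp add: twisted_automorphisms_def F_def free_algebra_ops twist_def)
  next
    case (diff p q)
    then have pq: "p \<in> carrier F" "q \<in> carrier F" by (simp_all add: F_def)
    have "I +>\<^bsub>F\<^esub> (p - q) = I +>\<^bsub>F\<^esub> (p \<ominus>\<^bsub>F\<^esub> q)"
      using pq by (simp add: F_def a_minus_def a_inv_free_algebra free_algebra_ops)
    also have "\<dots> = (I +>\<^bsub>F\<^esub> p) \<ominus>\<^bsub>F Quot I\<^esub> (I +>\<^bsub>F\<^esub> q)"
      using pq by (simp add: a_minus_def)
    finally show ?case
      using diff(3,4) pq twisted_automorphism_minus[OF Q \<phi>] twisted_automorphism_minus[OF Q \<psi>]
      unfolding F_def[symmetric] by simp
  qed
  show ?thesis
  proof (rule extensionalityI)
    show "\<phi> \<in> extensional (carrier (F Quot I))" "\<psi> \<in> extensional (carrier (F Quot I))"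
      using \<phi> \<psi> by (simp_all add: twisted_automorphisms_def)
    fix x assume "x \<in> carrier (F Quot I)"
    then obtain p where "p \<in> carrier F" "x = I +>\<^bsub>F\<^esub> p"
      unfolding carrier_FactRing by blast
    then show "\<phi> x = \<psi> x" using agree by metis
  qed
qed

text \<open>The involution hypothesis \<open>inv\<close> does double duty: it upgrades stability of
  \<open>I\<close> to invariance, and it makes the induced map its own inverse.\<close>

lemma ex1_twisted_automorphism:
  fixes X :: "'g set" and G
  defines "F \<equiv> free_algebra X"
  defines "I \<equiv> Idl\<^bsub>F\<^esub> G"
  assumes G: "G \<subseteq> carrier F"
    and f: "\<And>x. x \<in> X \<Longrightarrow> f x \<in> carrier F"
    and inv: "\<And>x. x \<in> X \<Longrightarrow> subst b f (f x) = var x"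
    and sG: "\<And>p. p \<in> G \<Longrightarrow> subst b f p \<in> I"
  shows "\<exists>!\<phi>. \<phi> \<in> twisted_automorphisms b (F Quot I) \<and>
    (\<forall>x\<in>X. \<phi> (I +>\<^bsub>F\<^esub> var x) = I +>\<^bsub>F\<^esub> f x)"
proof -
  interpret F: ring F unfolding F_def by (rule ring_free_algebra)
  interpret I: ideal I F unfolding I_def by (rule F.genideal_ideal[OF G])
  interpret \<pi>: ring_hom_ring F "F Quot I" "(+>\<^bsub>F\<^esub>) I" by (rule I.rcos_ring_hom_ring)
  let ?h = "subst b f" and ?C = "carrier (F Quot I)"
  have h_closed: "?h p \<in> carrier F" if "p \<in> carrier F" for p
    using that f by (simp add: F_def subst_closed)
  have h_h: "?h (?h p) = p" if "p \<in> carrier F" for p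
    using that inv by (simp add: F_def subst_involutive)
  have h_I: "?h p \<in> I" if "p \<in> I" for p
    using G f sG that unfolding F_def I_def by (rule subst_genideal)
  \<comment> \<open>Equality rather than inclusion is needed: only then is the image of a coset a
    whole coset.\<close>
  have image_I: "?h ` I = I"
  proof
    show "I \<subseteq> ?h ` I"
    proof
      fix p assume "p \<in> I"
      then show "p \<in> ?h ` I"
        using h_I[of p] h_h[of p] I.a_subset by (intro image_eqI[of _ _ "?h p"]) auto
    qed
  qed (use h_I in blast)
  have coset: "I +>\<^bsub>F\<^esub> p = (\<lambda>i. i + p) ` I" for p
    by (auto simp: a_r_coset_def' F_def free_algebra_ops)
  have image_coset: "?h ` (I +>\<^bsub>F\<^esub> p) = I +>\<^bsub>F\<^esub> ?h p" for p
  proof -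
    have "?h ` (I +>\<^bsub>F\<^esub> p) = (\<lambda>i. i + ?h p) ` ?h ` I"
      by (simp add: coset image_image subst_add)
    then show ?thesis by (simp add: image_I coset)
  qed
  have C: "?C = (\<lambda>p. I +>\<^bsub>F\<^esub> p) ` carrier F"
    by (rule carrier_FactRing)
  \<comment> \<open>Taking direct images of cosets avoids choosing representatives, so no
    well-definedness argument arises; \<open>restrict\<close> provides extensionality.\<close>
  define \<phi> where "\<phi> = restrict ((`) ?h) ?C"
  have \<phi>: "\<phi> (I +>\<^bsub>F\<^esub> p) = I +>\<^bsub>F\<^esub> ?h p" if "p \<in> carrier F" for p
    using that by (simp add: \<phi>_def C image_coset)
  have "\<phi> \<in> twisted_automorphisms b (F Quot I)"
    unfolding twisted_automorphisms_def
  proof (intro CollectI conjI ballI)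
    show "\<phi> \<in> extensional ?C" by (simp add: \<phi>_def)
    show "bij_betw \<phi> ?C ?C"
      by (rule bij_betw_byWitness[of _ \<phi>]) (auto simp: C \<phi> h_closed h_h)
    show "\<phi> \<one>\<^bsub>F Quot I\<^esub> = \<one>\<^bsub>F Quot I\<^esub>"
      using \<phi>[OF F.one_closed] \<pi>.hom_one
      by (simp add: F_def free_algebra_ops subst_one)
  next
    fix x y assume "x \<in> ?C" "y \<in> ?C"
    then obtain p q where [simp]: "x = I +>\<^bsub>F\<^esub> p" "y = I +>\<^bsub>F\<^esub> q"
      and pq: "p \<in> carrier F" "q \<in> carrier F" by (auto simp: C)
    have "?h (p \<oplus>\<^bsub>F\<^esub> q) = ?h p \<oplus>\<^bsub>F\<^esub> ?h q"
      by (simp add: F_def free_algebra_ops subst_add)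
    then show "\<phi> (x \<oplus>\<^bsub>F Quot I\<^esub> y) = \<phi> x \<oplus>\<^bsub>F Quot I\<^esub> \<phi> y"
      using pq by (simp add: \<phi> h_closed flip: \<pi>.hom_add)
    have "?h (p \<otimes>\<^bsub>F\<^esub> q) = twist b (mult F) (?h p) (?h q)"
      by (simp add: F_def free_algebra_ops subst_mult)
    then show "\<phi> (x \<otimes>\<^bsub>F Quot I\<^esub> y) = twist b (mult (F Quot I)) (\<phi> x) (\<phi> y)"
      using pq h_closed[OF pq(1)] h_closed[OF pq(2)]
      by (cases b; simp add: \<phi> h_closed twist_def flip: \<pi>.hom_mult)
  qed
  moreover have "\<forall>x\<in>X. \<phi> (I +>\<^bsub>F\<^esub> var x) = I +>\<^bsub>F\<^esub> f x"
    using \<phi> unfolding F_def by (simp add: var_in_free_algebra subst_var)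
  ultimately show ?thesis
    using twisted_automorphism_eqI[of I X _ b] I.ideal_axioms unfolding F_def
    by (intro ex1I[of _ \<phi>]) auto
qed

section \<open>The three involutions of \<open>H(S_n)\<close>\<close>

lemma rel_ideal_relation:
  assumes "(p, q) \<in> relations n"
  shows "p - q \<in> rel_ideal n"
proof -
  interpret ring "free_algebra (gens n)" by (rule ring_free_algebra)
  show ?thesis
    unfolding rel_ideal_def
    using genideal_self[of "{p - q |p q. (p, q) \<in> relations n}"] assms relations_in_free_algebra
    by blast
qed

lemma rel_ideal_add: "\<lbrakk>p \<in> rel_ideal n; q \<in> rel_ideal n\<rbrakk> \<Longrightarrow> p + q \<in> rel_ideal n"
  and rel_ideal_uminus: "p \<in> rel_ideal n \<Longrightarrow> - p \<in> rel_ideal n"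
proof -
  interpret F: ring "free_algebra (gens n)" by (rule ring_free_algebra)
  interpret I: ideal "rel_ideal n" "free_algebra (gens n)" by (rule ideal_rel_ideal)
  show "\<lbrakk>p \<in> rel_ideal n; q \<in> rel_ideal n\<rbrakk> \<Longrightarrow> p + q \<in> rel_ideal n"
    using I.a_closed[of p q] by (simp add: free_algebra_ops)
  show "p \<in> rel_ideal n \<Longrightarrow> - p \<in> rel_ideal n"
    using I.a_inv_closed[of p] by (simp add: a_inv_free_algebra)
qed

lemma rel_ideal_diff: "\<lbrakk>p \<in> rel_ideal n; q \<in> rel_ideal n\<rbrakk> \<Longrightarrow> p - q \<in> rel_ideal n"
  using rel_ideal_add[of p n "- q"] rel_ideal_uminus[of q n] by simp

abbreviation (input) "s i \<equiv> var (S i)"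
abbreviation (input) "d i \<equiv> var (D i)"

lemma rel_ideal_single:
  assumes "i \<in> {1..<n}"
  shows "s i * s i - 1 \<in> rel_ideal n"
    and "s i * d i + d i * s i - (s i - 1) \<in> rel_ideal n"
    and "d i * d i - d i \<in> rel_ideal n"
  by (rule rel_ideal_relation; use assms in \<open>unfold relations_def Let_def, blast\<close>)+

lemma rel_ideal_far:
  assumes "i \<in> {1..<n}" "j \<in> {1..<n}" "far i j"
  shows "s j * s i - s i * s j \<in> rel_ideal n"
    and "d j * s i - s i * d j \<in> rel_ideal n"
    and "d j * d i - d i * d j \<in> rel_ideal n"
  by (rule rel_ideal_relation; use assms in \<open>unfold relations_def Let_def, blast\<close>)+

lemma rel_ideal_adjacent:
  assumes "i \<in> {1..<n}" "j \<in> {1..<n}" "adjacent i j"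
  shows "s j * s i * s j - s i * s j * s i \<in> rel_ideal n"
    and "d i * s j * s i - s j * s i * d j \<in> rel_ideal n"
    and "d j * s i * d j - (s i * d j * d i + d i * d j * s i + s i * d j * s i) \<in> rel_ideal n"
  by (rule rel_ideal_relation; use assms in \<open>unfold relations_def Let_def, blast\<close>)+

text \<open>The index conditions are supplied in both orders, because some images also involve the
  relations with \<open>i\<close> and \<open>j\<close> exchanged.\<close>

lemma relations_cases [consumes 1, case_names single far adjacent]:
  assumes "(p, q) \<in> relations n"
    and "\<And>i. \<lbrakk>i \<in> {1..<n}; (p, q) \<in> {(s i * s i, 1), (s i * d i + d i * s i, s i - 1),
      (d i * d i, d i)}\<rbrakk> \<Longrightarrow> thesis"
    and "\<And>i j. \<lbrakk>i \<in> {1..<n}; j \<in> {1..<n}; far i j; far j i; (p, q) \<in> {(s j * s i, s i * s j),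
      (d j * s i, s i * d j), (d j * d i, d i * d j)}\<rbrakk> \<Longrightarrow> thesis"
    and "\<And>i j. \<lbrakk>i \<in> {1..<n}; j \<in> {1..<n}; adjacent i j; adjacent j i;
      (p, q) \<in> {(s j * s i * s j, s i * s j * s i), (d i * s j * s i, s j * s i * d j),
        (d j * s i * d j, s i * d j * d i + d i * d j * s i + s i * d j * s i)}\<rbrakk> \<Longrightarrow> thesis"
  shows thesis
proof -
  have sym: "\<bar>int i - int j\<bar> = \<bar>int j - int i\<bar>" for i j by simp
  show ?thesis
    using assms(1) unfolding relations_def Let_def Un_iff UN_iff
  proof (elim disjE bexE)
    fix i assume "i \<in> {1..<n}" "(p, q) \<in> {(s i * s i, 1),
      (s i * d i + d i * s i, s i - 1), (d i * d i, d i)}"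
    then show thesis by (rule assms(2))
  next
    fix i j assume "i \<in> {1..<n}" "j \<in> {j \<in> {1..<n}. far i j}" "(p, q) \<in> {(s j * s i, s i * s j),
      (d j * s i, s i * d j), (d j * d i, d i * d j)}"
    then show thesis by (intro assms(3)[of i j]) (simp_all only: mem_Collect_eq sym)
  next
    fix i j assume "i \<in> {1..<n}" "j \<in> {j \<in> {1..<n}. adjacent i j}"
      "(p, q) \<in> {(s j * s i * s j, s i * s j * s i), (d i * s j * s i, s j * s i * d j),
        (d j * s i * d j, s i * d j * d i + d i * d j * s i + s i * d j * s i)}"
    then show thesis by (intro assms(4)[of i j]) (simp_all only: mem_Collect_eq sym)
  qed
qed

section \<open>Specialisation to \<open>HS\<close> and computation with cosets\<close>

lemma gens_iff: "S i \<in> gens n \<longleftrightarrow> i \<in> {1..<n}" "D i \<in> gens n \<longleftrightarrow> i \<in> {1..<n}"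
  by (auto simp: gens_def)

text \<open>Leaves only checks in the free algebra. The parameters \<open>s'\<close> and
  \<open>d'\<close> let the images be stated by operations of \<open>HS n\<close> instead of cosets
  of polynomials.\<close>

lemma ex1_HS:
  assumes closed: "\<And>x. x \<in> gens n \<Longrightarrow> f x \<in> carrier (free_algebra (gens n))"
    and inv: "\<And>x. x \<in> gens n \<Longrightarrow> subst b f (f x) = var x"
    and rel: "\<And>p q. (p, q) \<in> relations n \<Longrightarrow> subst b f p - subst b f q \<in> rel_ideal n"
    and S: "\<And>i. i \<in> {1..<n} \<Longrightarrow> rel_ideal n +>\<^bsub>free_algebra (gens n)\<^esub> f (S i) = s' i"
    and D: "\<And>i. i \<in> {1..<n} \<Longrightarrow> rel_ideal n +>\<^bsub>free_algebra (gens n)\<^esub> f (D i) = d' i"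
  shows "\<exists>!\<phi>. \<phi> \<in> twisted_automorphisms b (HS n) \<and>
    (\<forall>i\<in>{1..<n}. \<phi> (s_gen n i) = s' i \<and> \<phi> (D_gen n i) = d' i)"
proof -
  let ?F = "free_algebra (gens n)"
  have "\<exists>!\<phi>. \<phi> \<in> twisted_automorphisms b (?F Quot rel_ideal n) \<and>
    (\<forall>x\<in>gens n. \<phi> (rel_ideal n +>\<^bsub>?F\<^esub> var x) = rel_ideal n +>\<^bsub>?F\<^esub> f x)"
    unfolding rel_ideal_def
  proof (rule ex1_twisted_automorphism)
    show "{p - q |p q. (p, q) \<in> relations n} \<subseteq> carrier ?F"
      using relations_in_free_algebra by blast
    fix p assume "p \<in> {p - q |p q. (p, q) \<in> relations n}"
    then show "subst b f p \<in> Idl\<^bsub>?F\<^esub> {p - q |p q. (p, q) \<in> relations n}"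
      unfolding rel_ideal_def[symmetric] using rel by (auto simp: subst_diff)
  qed (use closed inv in auto)
  moreover have "(\<forall>x\<in>gens n. \<phi> (rel_ideal n +>\<^bsub>?F\<^esub> var x) = rel_ideal n +>\<^bsub>?F\<^esub> f x) \<longleftrightarrow>
    (\<forall>i\<in>{1..<n}. \<phi> (s_gen n i) = s' i \<and> \<phi> (D_gen n i) = d' i)" for \<phi>
    using S D by (auto simp: gens_def s_gen_def D_gen_def)
  ultimately show ?thesis by (simp only: HS_def)
qed

lemma coset_one: "rel_ideal n +>\<^bsub>free_algebra (gens n)\<^esub> 1 = \<one>\<^bsub>HS n\<^esub>"
  and coset_add: "\<lbrakk>p \<in> carrier (free_algebra (gens n)); q \<in> carrier (free_algebra (gens n))\<rbrakk> \<Longrightarrow>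
    rel_ideal n +>\<^bsub>free_algebra (gens n)\<^esub> (p + q) =
      (rel_ideal n +>\<^bsub>free_algebra (gens n)\<^esub> p) \<oplus>\<^bsub>HS n\<^esub> (rel_ideal n +>\<^bsub>free_algebra (gens n)\<^esub> q)"
  and coset_uminus: "p \<in> carrier (free_algebra (gens n)) \<Longrightarrow>
    rel_ideal n +>\<^bsub>free_algebra (gens n)\<^esub> (- p) =
      \<ominus>\<^bsub>HS n\<^esub> (rel_ideal n +>\<^bsub>free_algebra (gens n)\<^esub> p)"
proof -
  interpret I: ideal "rel_ideal n" "free_algebra (gens n)" by (rule ideal_rel_ideal)
  interpret \<pi>: ring_hom_ring "free_algebra (gens n)" "HS n"
    "(+>\<^bsub>free_algebra (gens n)\<^esub>) (rel_ideal n)"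
    unfolding HS_def by (rule I.rcos_ring_hom_ring)
  show "rel_ideal n +>\<^bsub>free_algebra (gens n)\<^esub> 1 = \<one>\<^bsub>HS n\<^esub>"
    using \<pi>.hom_one by (simp add: free_algebra_ops)
  show "\<lbrakk>p \<in> carrier (free_algebra (gens n)); q \<in> carrier (free_algebra (gens n))\<rbrakk> \<Longrightarrow>
    rel_ideal n +>\<^bsub>free_algebra (gens n)\<^esub> (p + q) =
      (rel_ideal n +>\<^bsub>free_algebra (gens n)\<^esub> p) \<oplus>\<^bsub>HS n\<^esub> (rel_ideal n +>\<^bsub>free_algebra (gens n)\<^esub> q)"
    using \<pi>.hom_add[of p q] by (simp add: free_algebra_ops)
  show "p \<in> carrier (free_algebra (gens n)) \<Longrightarrow>
    rel_ideal n +>\<^bsub>free_algebra (gens n)\<^esub> (- p) =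
      \<ominus>\<^bsub>HS n\<^esub> (rel_ideal n +>\<^bsub>free_algebra (gens n)\<^esub> p)"
    using \<pi>.hom_a_inv[of p] by (simp add: a_inv_free_algebra)
qed

lemma coset_diff:
  assumes "p \<in> carrier (free_algebra (gens n))" "q \<in> carrier (free_algebra (gens n))"
  shows "rel_ideal n +>\<^bsub>free_algebra (gens n)\<^esub> (p - q) =
    (rel_ideal n +>\<^bsub>free_algebra (gens n)\<^esub> p) \<ominus>\<^bsub>HS n\<^esub> (rel_ideal n +>\<^bsub>free_algebra (gens n)\<^esub> q)"
  using coset_add[of p n "- q"] coset_uminus[of q n] assms
  by (simp add: a_minus_def uminus_in_free_algebra)

lemmas coset_simps = coset_one coset_add coset_uminus coset_diff

section \<open>The three substitutions and their effect on the relations\<close>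

definition complement_gen :: "gen \<Rightarrow> gen word \<Rightarrow>\<^sub>0 int"
  where "complement_gen x = (case x of S i \<Rightarrow> - var (S i) | D i \<Rightarrow> 1 - var (D i))"

text \<open>Involutive on generators: \<open>D i\<close> goes to \<open>s i + d i\<close> and then
  to \<open>- s i + (s i + d i) = d i\<close>.\<close>

definition shift_gen :: "gen \<Rightarrow> gen word \<Rightarrow>\<^sub>0 int"
  where "shift_gen x = (case x of S i \<Rightarrow> - var (S i) | D i \<Rightarrow> var (S i) + var (D i))"

text \<open>Writing each relation as a difference, those with one index or far indices are fixed,
  and the first two adjacent ones change sign.\<close>

lemma complement_gen_relations:
  assumes "(p, q) \<in> relations n"
  shows "subst False complement_gen p - subst False complement_gen q \<in> rel_ideal n"
  using assms
proof (cases rule: relations_cases)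
  case (single i)
  note r = rel_ideal_single[OF single(1)]
  show ?thesis
    using single(2) r rel_ideal_uminus[OF r(2)]
    by safe (simp_all add: subst_simps twist_def complement_gen_def algebra_simps)
next
  case (far i j)
  note r = rel_ideal_far[OF far(1-3)]
  show ?thesis
    using far(5) r
    by safe (simp_all add: subst_simps twist_def complement_gen_def algebra_simps)
next
  case (adjacent i j)
  note r = rel_ideal_adjacent[OF adjacent(1-3)]
  \<comment> \<open>Besides minus itself, the third adjacent relation yields
    \<open>- (s i * s i + s i * d i + d i * s i - s i)\<close>, which is minus the sum of these two
    relations.\<close>
  note r1 = rel_ideal_single(1,2)[OF adjacent(1)]
  show ?thesis
    using adjacent(5) r rel_ideal_uminus[OF r(1)] rel_ideal_uminus[OF r(2)]
      rel_ideal_uminus[OF rel_ideal_add[OF r(3) rel_ideal_add[OF r1]]]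
    by safe (simp_all add: subst_simps twist_def complement_gen_def algebra_simps)
qed

text \<open>Expanding the image of each relation and grouping terms by their number of
  \<open>D\<close> letters exhibits it as a signed sum of relations.\<close>

lemma shift_gen_relations:
  assumes "(p, q) \<in> relations n"
  shows "subst False shift_gen p - subst False shift_gen q \<in> rel_ideal n"
  using assms
proof (cases rule: relations_cases)
  case (single i)
  note r = rel_ideal_single[OF single(1)]
  have "s i * s i + (s i * d i + d i * s i) - s i \<in> rel_ideal n"
    using rel_ideal_add[OF r(1,2)] by (simp add: algebra_simps)
  note r2 = rel_ideal_diff[OF rel_ideal_uminus[OF r(1)] this]
  \<comment> \<open>The image of \<open>d i * d i - d i\<close> is the sum of all three relations
    for \<open>i\<close>.\<close>
  note r3 = rel_ideal_add[OF r(1) rel_ideal_add[OF r(2) r(3)]]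
  show ?thesis
    using single(2) r(1) r2 r3
    by safe (simp_all add: subst_simps twist_def shift_gen_def algebra_simps)
next
  case (far i j)
  note r = rel_ideal_far[OF far(1-3)]
  note r' = rel_ideal_far[OF far(2,1,4)]
  have r2: "- (s j * s i - s i * s j) - (d j * s i - s i * d j) \<in> rel_ideal n"
    by (intro rel_ideal_diff rel_ideal_uminus r)
  \<comment> \<open>The commutator of the two sums splits into four commutators; that of
    \<open>s j\<close> and \<open>d i\<close> is a relation only with the indices exchanged, up to
    sign.\<close>
  have r3: "(s j * s i - s i * s j) + (d j * s i - s i * d j) - (d i * s j - s j * d i)
      + (d j * d i - d i * d j) \<in> rel_ideal n"
    by (intro rel_ideal_add rel_ideal_diff r r')
  show ?thesis
    using far(5) r(1) r2 r3
    by safe (simp_all add: subst_simps twist_def shift_gen_def algebra_simps)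
next
  case (adjacent i j)
  note r = rel_ideal_adjacent[OF adjacent(1-3)]
  note r' = rel_ideal_adjacent[OF adjacent(2,1,4)]
  have r2: "(s i * s j * s i - s j * s i * s j) + (d i * s j * s i - s j * s i * d j)
      \<in> rel_ideal n"
    by (intro rel_ideal_add r r')
  \<comment> \<open>The grouped expansion of the image of the third adjacent relation; its third
    summand uses the mixed relation with the indices exchanged.\<close>
  have r3: "- (s j * s i * s j - s i * s j * s i) + (d i * s j * s i - s j * s i * d j)
      - (d j * s i * s j - s i * s j * d i)
      - (d j * s i * d j - (s i * d j * d i + d i * d j * s i + s i * d j * s i)) \<in> rel_ideal n"
    by (intro rel_ideal_add rel_ideal_diff rel_ideal_uminus r r')
  show ?thesis
    using adjacent(5) rel_ideal_uminus[OF r(1)] r2 r3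
    by safe (simp_all add: subst_simps twist_def shift_gen_def algebra_simps)
qed

text \<open>Reversal fixes the one-index relations and negates the far ones. Of the adjacent ones,
  the first and third are invariant, while the second becomes minus its instance with
  \<open>i\<close> and \<open>j\<close> exchanged.\<close>

lemma reverse_relations:
  assumes "(p, q) \<in> relations n"
  shows "subst True var p - subst True var q \<in> rel_ideal n"
  using assms
proof (cases rule: relations_cases)
  case (single i)
  note r = rel_ideal_single[OF single(1)]
  show ?thesis
    using single(2) r by safe (simp_all add: subst_simps twist_def algebra_simps)
next
  case (far i j)
  note r = rel_ideal_far[OF far(1-3)]
  show ?thesis
    using far(5) r[THEN rel_ideal_uminus]
    by safe (simp_all add: subst_simps twist_def algebra_simps)
next
  case (adjacent i j)
  note r = rel_ideal_adjacent[OF adjacent(1-3)]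
  note r' = rel_ideal_adjacent[OF adjacent(2,1,4)]
  show ?thesis
    using adjacent(5) r rel_ideal_uminus[OF r'(2)]
    by safe (simp_all add: subst_simps twist_def algebra_simps)
qed

theorem theorem1p5:
  fixes n :: nat
  assumes "n \<ge> 2"
  shows "(\<exists>!\<phi>. \<phi> \<in> automorphisms (HS n) \<and>
            (\<forall>i\<in>{1..<n}. \<phi> (s_gen n i) = \<ominus>\<^bsub>HS n\<^esub> s_gen n i \<and>
                         \<phi> (D_gen n i) = \<one>\<^bsub>HS n\<^esub> \<ominus>\<^bsub>HS n\<^esub> D_gen n i)) \<and>
         (\<exists>!\<phi>. \<phi> \<in> automorphisms (HS n) \<and>
            (\<forall>i\<in>{1..<n}. \<phi> (s_gen n i) = \<ominus>\<^bsub>HS n\<^esub> s_gen n i \<and>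
                         \<phi> (D_gen n i) = s_gen n i \<oplus>\<^bsub>HS n\<^esub> D_gen n i)) \<and>
         (\<exists>!\<phi>. \<phi> \<in> antiautomorphisms (HS n) \<and>
            (\<forall>i\<in>{1..<n}. \<phi> (s_gen n i) = s_gen n i \<and>
                         \<phi> (D_gen n i) = D_gen n i))"
proof (intro conjI)
  show "\<exists>!\<phi>. \<phi> \<in> automorphisms (HS n) \<and>
            (\<forall>i\<in>{1..<n}. \<phi> (s_gen n i) = \<ominus>\<^bsub>HS n\<^esub> s_gen n i \<and>
                         \<phi> (D_gen n i) = \<one>\<^bsub>HS n\<^esub> \<ominus>\<^bsub>HS n\<^esub> D_gen n i)"
    unfolding twisted_automorphisms_False[symmetric]
    \<comment> \<open>The relation lemma fixes both the flag and \<open>f\<close>; closure,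
      involutivity and the two coset computations remain for \<open>auto\<close>.\<close>
    by (rule ex1_HS[OF _ _ complement_gen_relations])
      (auto simp: complement_gen_def subst_simps free_algebra_closed gens_iff coset_simps
        s_gen_def D_gen_def split: gen.split)
  show "\<exists>!\<phi>. \<phi> \<in> automorphisms (HS n) \<and>
            (\<forall>i\<in>{1..<n}. \<phi> (s_gen n i) = \<ominus>\<^bsub>HS n\<^esub> s_gen n i \<and>
                         \<phi> (D_gen n i) = s_gen n i \<oplus>\<^bsub>HS n\<^esub> D_gen n i)"
    unfolding twisted_automorphisms_False[symmetric]
    by (rule ex1_HS[OF _ _ shift_gen_relations])
      (auto simp: shift_gen_def subst_simps free_algebra_closed gens_iff coset_simps
        s_gen_def D_gen_def split: gen.split)
  show "\<exists>!\<phi>. \<phi> \<in> antiautomorphisms (HS n) \<and>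
            (\<forall>i\<in>{1..<n}. \<phi> (s_gen n i) = s_gen n i \<and> \<phi> (D_gen n i) = D_gen n i)"
    unfolding twisted_automorphisms_True[symmetric]
    \<comment> \<open>With \<open>f = var\<close> and the flag \<open>True\<close>,
      \<open>subst\<close> is plain word reversal, so every generator is fixed.\<close>
    by (rule ex1_HS[OF _ _ reverse_relations])
      (auto simp: subst_var var_in_free_algebra s_gen_def D_gen_def)
qed

end
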